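(* Let $A\in\mathbb{R}^{N\times N}$ satisfy the standing assumptions given in the context. 1. Let $y^*>0$ be a positive steady state of the differential equation $y'=Ay$, i.e. $Ay^*=0$. Then $y^*$ is a (Lyapunov) stable fixed point of the MPRK(3,2) scheme applied to $y'=Ay$ for all $\Delta t>0$. 2. Let $y^*>0$ be the unique steady state of the initial value problem $y'=Ay$, $y(0)=y^0>0$. Then, for all $\Delta t>0$, the iterates $y^n$ of the MPRK(3,2) scheme started at $y^0$ converge to $y^*$ as $n\to\infty$, if $y^0$ is close enough to $y^*$; that is, for each $\Delta t>0$ there is a $\delta>0$ such that $\|y^0-y^*\|<\delta$ implies $y^n\to y^*$.
   Context: Inequalities between vectors are componentwise; $\operatorname{diag}(v)$ is the diagonal matrix with diagonal $v$. Standing assumptions on $A\in\mathbb{R}^{N\times N}$: $A\ne 0$; all off-diagonal entries of $A$ are nonnegative; $(1,\dots,1)^T\in\ker(A^T)$; the eigenvalue $0$ of $A$ has equal algebraic and geometric multiplicity $k\ge 1$; every eigenvalue $\lambda$ of $A$ satisfies $\operatorname{Re}(\lambda)\le 0$. Steady state of the initial value problem: the unique vector $y^*$ with $Ay^*=0$ and $n^Ty^*=n^Ty^0$ for all $n\in\ker(A^T)$. The MPRK(3,2) scheme with step size $\Delta t>0$, applied to $y'=Ay$ (written as a production-destruction system with $p_{ij}(y)=d_{ji}(y)=a_{ij}y_j$ for $i\neq j$, $p_{ii}=d_{ii}=0$), maps $y^n>0$ to $y^{n+1}=g(y^n)$ by successively solving the linear systems $$y^{(1)}=y^n+\Delta t\,A\,y^{(1)},$$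 $$y^{(2)}=y^n+\tfrac{\Delta t}{4}A\operatorname{diag}(y^{(2)})\operatorname{diag}(y^{(1)})^{-1}(y^n+y^{(1)}),$$ $$y^{n+1}=y^n+\tfrac{\Delta t}{6}A\operatorname{diag}(y^{n+1})\operatorname{diag}(y^{(1)})^{-1}(y^n+y^{(1)}+4y^{(2)}).$$ A fixed point $y^*=g(y^* )$ of the iteration $y^{n+1}=g(y^n)$ is (Lyapunov) stable if for every $\epsilon>0$ there is $\delta>0$ such that $\|y^0-y^*\|<\delta$ implies $\|y^n-y^*\|<\epsilon$ for all $n\ge 0$. *)

theory Defs
  imports "HOL-Analysis.Analysis" "HOL-Computational_Algebra.Polynomial"
begin

(* The library order on vectors makes x < y mean x \<le> y and x \<noteq> y, so the strict
   componentwise inequality needs its own predicate. *)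
definition positive_vec :: "real^'n \<Rightarrow> bool" where
  "positive_vec v \<longleftrightarrow> (\<forall>i. 0 < v $ i)"

definition diag_matrix :: "real^'n \<Rightarrow> real^'n^'n" where
  "diag_matrix v = (\<chi> i j. if i = j then v $ i else 0)"

definition mat_kernel :: "'a::comm_ring_1^'n^'m \<Rightarrow> ('a^'n) set" where
  "mat_kernel A = {v. A *v v = 0}"

definition charpoly :: "'a::comm_ring_1^'n^'n \<Rightarrow> 'a poly" where
  "charpoly A = det (mat [:0, 1:] - (\<chi> i j. [:A $ i $ j:]))"

definition is_eigenvalue :: "'a::field^'n^'n \<Rightarrow> 'a \<Rightarrow> bool" where
  "is_eigenvalue A \<mu> \<longleftrightarrow> (\<exists>v. v \<noteq> 0 \<and> A *v v = \<mu> *s v)"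

definition algebraic_multiplicity :: "'a::field^'n^'n \<Rightarrow> 'a \<Rightarrow> nat" where
  "algebraic_multiplicity A \<mu> = order \<mu> (charpoly A)"

definition geometric_multiplicity :: "'a::field^'n^'n \<Rightarrow> 'a \<Rightarrow> nat" where
  "geometric_multiplicity A \<mu> = vec.dim {v. A *v v = \<mu> *s v}"

definition complex_matrix :: "real^'n^'n \<Rightarrow> complex^'n^'n" where
  "complex_matrix A = (\<chi> i j. complex_of_real (A $ i $ j))"

definition standing_assumptions :: "real^'n^'n \<Rightarrow> bool" where
  "standing_assumptions A \<longleftrightarrow>
     A \<noteq> 0 \<and>
     (\<forall>i j. i \<noteq> j \<longrightarrow> 0 \<le> A $ i $ j) \<and>
     (\<chi> i. 1) \<in> mat_kernel (transpose A) \<and>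
     (\<exists>k\<ge>1. algebraic_multiplicity A 0 = k \<and> geometric_multiplicity A 0 = k) \<and>
     (\<forall>\<mu>. is_eigenvalue (complex_matrix A) \<mu> \<longrightarrow> Re \<mu> \<le> 0)"

(* The steady state of the initial value problem y' = A y, y(0) = y0. *)
definition is_steady_state_of_ivp :: "real^'n^'n \<Rightarrow> real^'n \<Rightarrow> real^'n \<Rightarrow> bool" where
  "is_steady_state_of_ivp A y0 ystar \<longleftrightarrow>
     A *v ystar = 0 \<and> (\<forall>n \<in> mat_kernel (transpose A). n \<bullet> ystar = n \<bullet> y0)"

(* The three stages are given by linear systems; for positive y (and 0 < dt) each of them is
   uniquely solvable, see mprk32_stages below. *)
definition mprk32_stage1 :: "real^'n^'n \<Rightarrow> real \<Rightarrow> real^'n \<Rightarrow> real^'n" where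
  "mprk32_stage1 A dt y = (THE y1. y1 = y + dt *\<^sub>R (A *v y1))"

definition mprk32_stage2 :: "real^'n^'n \<Rightarrow> real \<Rightarrow> real^'n \<Rightarrow> real^'n \<Rightarrow> real^'n" where
  "mprk32_stage2 A dt y y1 =
     (THE y2. y2 = y + (dt / 4) *\<^sub>R
        ((A ** diag_matrix y2 ** matrix_inv (diag_matrix y1)) *v (y + y1)))"

definition mprk32_stage3 :: "real^'n^'n \<Rightarrow> real \<Rightarrow> real^'n \<Rightarrow> real^'n \<Rightarrow> real^'n \<Rightarrow> real^'n" where
  "mprk32_stage3 A dt y y1 y2 =
     (THE z. z = y + (dt / 6) *\<^sub>R
        ((A ** diag_matrix z ** matrix_inv (diag_matrix y1)) *v (y + y1 + 4 *\<^sub>R y2)))"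

definition mprk32 :: "real^'n^'n \<Rightarrow> real \<Rightarrow> real^'n \<Rightarrow> real^'n" where
  "mprk32 A dt y =
     (let y1 = mprk32_stage1 A dt y;
          y2 = mprk32_stage2 A dt y y1
      in mprk32_stage3 A dt y y1 y2)"

definition lyapunov_stable_fixed_point :: "(real^'n \<Rightarrow> real^'n) \<Rightarrow> real^'n \<Rightarrow> bool" where
  "lyapunov_stable_fixed_point g ystar \<longleftrightarrow>
     g ystar = ystar \<and>
     (\<forall>\<epsilon>>0. \<exists>\<delta>>0. \<forall>y0. norm (y0 - ystar) < \<delta> \<longrightarrow>
        (\<forall>n. norm ((g ^^ n) y0 - ystar) < \<epsilon>))"


lemma diag_matrix_mult_vec: "diag_matrix v *v x = (\<chi> i. v $ i * x $ i)"
  by (simp add: diag_matrix_def matrix_vector_mult_def vec_eq_iff if_distrib if_distribR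
      cong: if_cong)

lemma matrix_inv_diag_matrix:
  assumes "positive_vec v"
  shows "matrix_inv (diag_matrix v) = diag_matrix (\<chi> i. inverse (v $ i))"
proof -
  let ?B = "diag_matrix (\<chi> i. inverse (v $ i))"
  have nz: "v $ i \<noteq> 0" for i
    using assms unfolding positive_vec_def by (metis less_irrefl)
  have "diag_matrix v ** ?B = mat 1"
    by (simp add: matrix_eq flip: matrix_vector_mul_assoc)
       (simp add: diag_matrix_mult_vec vec_eq_iff nz)
  moreover have "?B ** diag_matrix v = mat 1"
    by (simp add: matrix_eq flip: matrix_vector_mul_assoc)
       (simp add: diag_matrix_mult_vec vec_eq_iff nz)
  ultimately have ex: "diag_matrix v ** ?B = mat 1 \<and> ?B ** diag_matrix v = mat 1" by blast
  let ?C = "matrix_inv (diag_matrix v)"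
  have "diag_matrix v ** ?C = mat 1 \<and> ?C ** diag_matrix v = mat 1"
    unfolding matrix_inv_def using ex by (rule someI)
  then show ?thesis using ex by (metis matrix_mul_assoc matrix_mul_lid matrix_mul_rid)
qed

lemma patankar_product:
  assumes "positive_vec v"
  shows "(A ** diag_matrix z ** matrix_inv (diag_matrix v)) *v x =
         A *v (diag_matrix (\<chi> i. x $ i / v $ i) *v z)"
  by (simp add: matrix_inv_diag_matrix[OF assms] flip: matrix_vector_mul_assoc)
     (simp add: diag_matrix_mult_vec divide_inverse mult_ac)

(* I - diag(c) A^T has a nonnegative inverse, by a minimum principle. *)
lemma adjoint_nonneg:
  fixes A :: "real^'n^'n"
  assumes A: "\<forall>i j. i \<noteq> j \<longrightarrow> 0 \<le> A $ i $ j" "(\<chi> i. 1) \<in> mat_kernel (transpose A)"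
    and c: "positive_vec c"
    and x: "\<And>i. 0 \<le> x $ i - c $ i * (transpose A *v x) $ i"
  shows "0 \<le> x $ i"
proof -
  have "finite (range (\<lambda>i. x $ i))" by simp
  then have "\<exists>m. \<forall>j. x $ m \<le> x $ j"
    by (metis (mono_tags, lifting) Min_in Min_le UNIV_not_empty empty_is_image imageE rangeI)
  then obtain m where m: "\<And>j. x $ m \<le> x $ j" by blast
  have s: "(\<Sum>j\<in>UNIV. A $ j $ m) = 0"
    using A(2) by (simp add: mat_kernel_def matrix_vector_mult_def transpose_def vec_eq_iff)
  have "(transpose A *v x) $ m = (\<Sum>j\<in>UNIV. A $ j $ m * x $ j)"
    by (simp add: matrix_vector_mult_def transpose_def)
  also have "\<dots> = (\<Sum>j\<in>UNIV. A $ j $ m * (x $ j - x $ m))"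
    by (simp add: right_diff_distrib sum_subtractf s flip: sum_distrib_right)
  also have "\<dots> \<ge> 0"
  proof (rule sum_nonneg)
    fix j show "0 \<le> A $ j $ m * (x $ j - x $ m)"
      using A(1) m[of j] by (cases "j = m") auto
  qed
  finally have "0 \<le> c $ m * (transpose A *v x) $ m"
    using c by (simp add: positive_vec_def less_imp_le)
  then have "0 \<le> x $ m" using x[of m] by linarith
  then show ?thesis using m[of i] by linarith
qed

lemma patankar_system:
  fixes A :: "real^'n^'n"
  assumes A: "standing_assumptions A" and c: "positive_vec c" and y: "positive_vec y"
  shows "\<exists>!z. z = y + A *v (diag_matrix c *v z)"
    and "z = y + A *v (diag_matrix c *v z) \<Longrightarrow> positive_vec z"
proof -
  note A' = A[unfolded standing_assumptions_def]
  have off: "\<forall>i j. i \<noteq> j \<longrightarrow> 0 \<le> A $ i $ j" and ker: "(\<chi> i. 1) \<in> mat_kernel (transpose A)"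
    using A' by blast+
  define T where "T = mat 1 - diag_matrix c ** transpose A"
  have T: "(T *v x) $ i = x $ i - c $ i * (transpose A *v x) $ i" for x i
    by (simp add: T_def matrix_vector_mult_diff_rdistrib flip: matrix_vector_mul_assoc)
       (simp add: diag_matrix_mult_vec)
  have inj: "inj ((*v) T)"
  proof (rule iffD2[OF linear_injective_0[OF matrix_vector_mul_linear]], intro allI impI)
    fix x assume 0: "T *v x = 0"
    then have "T *v (- x) = 0" by (metis neg_0_equal_iff_equal linear_neg matrix_vector_mul_linear)
    then have "0 \<le> x $ i" "0 \<le> (- x) $ i" for i
      using adjoint_nonneg[OF off ker c, of x i] adjoint_nonneg[OF off ker c, of "- x" i]
        0 T[of x] T[of "- x"] by (metis order_refl zero_index)+
    then show "x = 0" by (simp add: vec_eq_iff order_antisym)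
  qed
  have inv: "invertible T"
    using inj by (simp add: invertible_left_inverse matrix_left_invertible_injective)
  have tD: "transpose (diag_matrix c) = diag_matrix c"
    by (simp add: diag_matrix_def transpose_def vec_eq_iff)
  have tT: "transpose T = mat 1 - A ** diag_matrix c"
  proof -
    have "transpose T = mat 1 - transpose (diag_matrix c ** transpose A)"
      by (simp add: T_def transpose_def vec_eq_iff mat_def)
    then show ?thesis by (simp add: matrix_transpose_mul tD)
  qed
  have sys: "z = y + A *v (diag_matrix c *v z) \<longleftrightarrow> transpose T *v z = y" for z
    by (simp add: tT matrix_vector_mult_diff_rdistrib matrix_vector_mul_assoc diff_eq_eq)
  have itT: "invertible (transpose T)"
    by (metis inv transpose_invertible)
  show "\<exists>!z. z = y + A *v (diag_matrix c *v z)"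
    unfolding sys by (metis itT invertible_def matrix_vector_mul_assoc matrix_vector_mul_lid)
  assume z: "z = y + A *v (diag_matrix c *v z)"
  show "positive_vec z"
    unfolding positive_vec_def
  proof
    fix i
    obtain x where x: "T *v x = axis i 1"
      by (metis inv invertible_def matrix_vector_mul_assoc matrix_vector_mul_lid)
    have xn: "0 \<le> x $ j" for j
      proof (rule adjoint_nonneg[OF off ker c])
      fix k show "0 \<le> x $ k - c $ k * (transpose A *v x) $ k"
        unfolding T[symmetric] by (simp add: x axis_def)
    qed
    have "x \<noteq> 0" using x by (auto simp: axis_eq_0_iff)
    then obtain j where j: "x $ j \<noteq> 0" by (auto simp: vec_eq_iff)
    have "z $ i = (T *v x) \<bullet> z" by (simp add: x inner_axis')
    also have "\<dots> = x \<bullet> y"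
      using z[unfolded sys] by (metis dot_lmul_matrix matrix_transpose_mul inner_commute transpose_matrix_vector)
    also have "\<dots> > 0"
      unfolding inner_vec_def
      by (rule sum_pos2[of _ j]) (use xn j y in \<open>auto simp: positive_vec_def less_le intro!: mult_nonneg_nonneg\<close>)
    finally show "0 < z $ i" .
  qed
qed

lemma mprk32_stages:
  fixes A :: "real^'n^'n"
  assumes A: "standing_assumptions A" and dt: "0 < dt" and y: "positive_vec y"
  defines "y1 \<equiv> mprk32_stage1 A dt y"
  defines "y2 \<equiv> mprk32_stage2 A dt y y1"
  shows "\<exists>!u. u = y + dt *\<^sub>R (A *v u)"
    and "y1 = y + dt *\<^sub>R (A *v y1)"
    and "positive_vec y1"
    and "\<exists>!u. u = y + (dt / 4) *\<^sub>R
        ((A ** diag_matrix u ** matrix_inv (diag_matrix y1)) *v (y + y1))"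
    and "y2 = y + (dt / 4) *\<^sub>R
        ((A ** diag_matrix y2 ** matrix_inv (diag_matrix y1)) *v (y + y1))"
    and "positive_vec y2"
    and "\<exists>!u. u = y + (dt / 6) *\<^sub>R
        ((A ** diag_matrix u ** matrix_inv (diag_matrix y1)) *v (y + y1 + 4 *\<^sub>R y2))"
    and "mprk32 A dt y = y + (dt / 6) *\<^sub>R
        ((A ** diag_matrix (mprk32 A dt y) ** matrix_inv (diag_matrix y1)) *v (y + y1 + 4 *\<^sub>R y2))"
    and "positive_vec (mprk32 A dt y)"
proof -
  have e1: "dt *\<^sub>R (A *v u) = A *v (diag_matrix (\<chi> i. dt) *v u)" for u
  proof -
    have "diag_matrix (\<chi> i. dt) *v u = dt *\<^sub>R u" by (simp add: diag_matrix_mult_vec vec_eq_iff)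
    then show ?thesis by (simp add: matrix_vector_mult_scaleR)
  qed
  have c1: "positive_vec (\<chi> i. dt)" using dt by (simp add: positive_vec_def)
  show u1: "\<exists>!u. u = y + dt *\<^sub>R (A *v u)"
    unfolding e1 by (rule patankar_system(1)[OF A c1 y])
  show y1: "y1 = y + dt *\<^sub>R (A *v y1)"
    unfolding y1_def mprk32_stage1_def by (rule theI'[OF u1])
  show p1: "positive_vec y1"
    using y1 unfolding e1 by (rule patankar_system(2)[OF A c1 y])
  have e: "s *\<^sub>R ((A ** diag_matrix u ** matrix_inv (diag_matrix y1)) *v x) =
      A *v (diag_matrix (\<chi> i. s * (x $ i / y1 $ i)) *v u)" for s u x
  proof -
    have "diag_matrix (\<chi> i. s * (x $ i / y1 $ i)) *v u =
        s *\<^sub>R (diag_matrix (\<chi> i. x $ i / y1 $ i) *v u)"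
      by (simp add: diag_matrix_mult_vec vec_eq_iff)
    then show ?thesis by (simp add: patankar_product[OF p1] matrix_vector_mult_scaleR)
  qed
  have c2: "positive_vec (\<chi> i. dt / 4 * ((y + y1) $ i / y1 $ i))"
    using dt y p1 by (simp add: positive_vec_def add_pos_pos)
  show u2: "\<exists>!u. u = y + (dt / 4) *\<^sub>R
        ((A ** diag_matrix u ** matrix_inv (diag_matrix y1)) *v (y + y1))"
    unfolding e by (rule patankar_system(1)[OF A c2 y])
  show y2: "y2 = y + (dt / 4) *\<^sub>R
        ((A ** diag_matrix y2 ** matrix_inv (diag_matrix y1)) *v (y + y1))"
    unfolding y2_def mprk32_stage2_def by (rule theI'[OF u2])
  show p2: "positive_vec y2"
    using y2 unfolding e by (rule patankar_system(2)[OF A c2 y])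
  have c3: "positive_vec (\<chi> i. dt / 6 * ((y + y1 + 4 *\<^sub>R y2) $ i / y1 $ i))"
    using dt y p1 p2 by (simp add: positive_vec_def add_pos_pos)
  show u3: "\<exists>!u. u = y + (dt / 6) *\<^sub>R
        ((A ** diag_matrix u ** matrix_inv (diag_matrix y1)) *v (y + y1 + 4 *\<^sub>R y2))"
    unfolding e by (rule patankar_system(1)[OF A c3 y])
  have m: "mprk32 A dt y = mprk32_stage3 A dt y y1 y2"
    by (simp add: mprk32_def Let_def y1_def y2_def)
  show y3: "mprk32 A dt y = y + (dt / 6) *\<^sub>R
        ((A ** diag_matrix (mprk32 A dt y) ** matrix_inv (diag_matrix y1)) *v (y + y1 + 4 *\<^sub>R y2))"
    unfolding m unfolding mprk32_stage3_def by (rule theI'[OF u3])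
  show "positive_vec (mprk32 A dt y)"
    using y3 unfolding e by (rule patankar_system(2)[OF A c3 y])
qed

end

theory Submission
  imports Defs
begin

text \<open>
  Stability is usually read off the spectrum of the Jacobian. Here it comes from an inner product.
  Given a positive steady state \<open>ystar\<close>, put \<open>s i = sqrt (ystar $ i)\<close> and measure vectors by
  the Euclidean norm of \<open>v $ i / s i\<close>. In these coordinates \<open>dt A\<close> becomes a dissipative operator
  \<open>L\<close>, that is \<open>x \<bullet> L x \<le> 0\<close>: the matrix with entries \<open>A $ i $ j * ystar $ j\<close> has vanishing row and
  column sums and nonnegative off-diagonal entries, so its quadratic form at \<open>w\<close> is minus half the
  sum of its entries times \<open>(w i - w j)\<^sup>2\<close>. For a dissipative operator the
  range is orthogonal to the kernel, so the space splits orthogonally into the steady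
  states and a complement that \<open>L\<close> maps injectively into itself.

  The scheme linearised at a steady state is \<open>R(L)\<close> for a rational function \<open>R\<close>. That
  \<open>R(L)\<close> strictly contracts the complement of the kernel is the content of
  \<open>denom_numer_identity\<close>, which writes the difference of the squared norms of the denominator and
  the numerator of \<open>R(L)\<close> as a sum of visibly nonnegative terms, one of them a multiple of
  \<open>(norm (L (L x)))\<^sup>2\<close>.

  Nonlinearity enters only through the Patankar quotients, and exactly: the deviations of the
  stages from a steady state \<open>z\<close> satisfy the linearised equations up to remainders that are
  products of a stage difference \<open>v - v1\<close> with small factors (\<open>patankar_product_expansion\<close>). These
  remainders are absorbed by the contraction (\<open>perturbed_contraction\<close>).

  Each step adds an element of the range of \<open>A\<close>, so the orthogonal projection \<open>z\<close> of the starting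
  value onto the steady states never changes, and the iterates
  converge geometrically to \<open>z\<close>. Since \<open>z\<close> is no farther from \<open>ystar\<close> than the starting value, this
  gives Lyapunov stability; when \<open>ystar\<close> is the steady state of the initial value problem, \<open>z\<close> is
  \<open>ystar\<close> itself, which gives convergence.
\<close>

section \<open>Dissipative operators and the stability function\<close>

lemma vector_eq_innerI:
  fixes x y :: "'a::real_inner"
  assumes "\<And>z. x \<bullet> z = y \<bullet> z" shows "x = y"
  using assms vector_eq_rdot by blast

locale dissipative =
  fixes L :: "'a::euclidean_space \<Rightarrow> 'a"
  assumes lin: "linear L" and diss: "x \<bullet> L x \<le> 0"
begin

lemmas L_simps = linear_add[OF lin] linear_diff[OF lin] linear_scale[OF lin] linear_0[OF lin]
  linear_neg[OF lin]

definition kernel_perp :: "'a set" where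
  "kernel_perp = {x. \<forall>k. L k = 0 \<longrightarrow> x \<bullet> k = 0}"

lemma subspace_kernel_perp: "subspace kernel_perp"
  by (auto simp: kernel_perp_def subspace_def inner_simps)

text \<open>Perturbing \<open>x\<close> by a multiple \<open>t\<close> of a kernel vector \<open>k\<close> changes \<open>x \<bullet> L x\<close> by the linear
  term \<open>t * (k \<bullet> L x)\<close>, which can stay bounded above for all \<open>t\<close> only if it vanishes.\<close>

lemma L_in_kernel_perp: "L x \<in> kernel_perp"
  unfolding kernel_perp_def
proof (safe)
  fix k assume k: "L k = 0"
  have *: "x \<bullet> L x + t * (k \<bullet> L x) \<le> 0" for t
    using diss[of "x + t *\<^sub>R k"] by (simp add: L_simps k inner_simps)
  have "k \<bullet> L x = 0"
  proof (rule ccontr)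
    assume "k \<bullet> L x \<noteq> 0"
    then show False using *[of "(1 - x \<bullet> L x) / (k \<bullet> L x)"] by simp
  qed
  then show "L x \<bullet> k = 0" by (simp add: inner_commute)
qed

lemma kernel_Int_kernel_perp:
  assumes "x \<in> kernel_perp" "L x = 0" shows "x = 0"
  using assms by (auto simp: kernel_perp_def)

lemma resolvent_bound:
  assumes "0 < a" shows "a * norm v \<le> norm (a *\<^sub>R v - L v)"
proof (cases "v = 0")
  case False
  have "a * (norm v * norm v) \<le> v \<bullet> (a *\<^sub>R v - L v)"
    using diss[of v] by (simp add: inner_simps flip: power2_eq_square power2_norm_eq_inner)
  also have "\<dots> \<le> norm v * norm (a *\<^sub>R v - L v)" by (rule norm_cauchy_schwarz)
  finally have "norm v * (a * norm v) \<le> norm v * norm (a *\<^sub>R v - L v)" by (simp add: mult_ac)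
  then show ?thesis using False by simp
qed (simp add: L_simps)

lemma implicit_euler_bound:
  assumes "v = u + L v" shows "norm v \<le> norm u"
proof -
  have "1 *\<^sub>R v - L v = u" using assms by (simp add: algebra_simps)
  then show ?thesis using resolvent_bound[of 1 v] by simp
qed

text \<open>The two functions below are the numerator and denominator of the stability function
  \<open>R(z) = (12 - 18 z - z^3) / (6 (1 - z)^2 (2 - z))\<close>, with \<open>z\<close> replaced by \<open>L\<close>: linearising the
  three stages of the scheme at any positive steady state turns one step into \<open>R(L)\<close>.\<close>

definition numer :: "'a \<Rightarrow> 'a" where
  "numer x = 12 *\<^sub>R x - 18 *\<^sub>R L x - L (L (L x))"

definition denom :: "'a \<Rightarrow> 'a" where
  "denom x = 12 *\<^sub>R x - 30 *\<^sub>R L x + 24 *\<^sub>R L (L x) - 6 *\<^sub>R L (L (L x))"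

lemma linear_denom: "linear denom"
  unfolding denom_def by (intro linearI) (simp_all add: L_simps algebra_simps)

lemma denom_factors:
  "denom x = 6 *\<^sub>R (let w = 2 *\<^sub>R x - L x; w' = w - L w in w' - L w')"
  by (simp add: denom_def Let_def L_simps algebra_simps flip: scaleR_add_left scaleR_2)

lemma denom_bound: "12 * norm x \<le> norm (denom x)"
proof -
  define w w' where "w = 2 *\<^sub>R x - L x" and "w' = w - L w"
  have "2 * norm x \<le> norm w" using resolvent_bound[of 2 x] by (simp add: w_def)
  also have "\<dots> \<le> norm w'" using resolvent_bound[of 1 w] by (simp add: w'_def)
  also have "\<dots> \<le> norm (w' - L w')" using resolvent_bound[of 1 w'] by simp
  finally show ?thesis by (simp add: denom_factors w_def w'_def Let_def)
qed

lemma surj_denom: "surj denom"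
proof -
  have "inj denom"
  proof (rule iffD2[OF linear_injective_0[OF linear_denom]], intro allI impI)
    fix x assume "denom x = 0"
    then show "x = 0" using denom_bound[of x] by simp
  qed
  then show ?thesis using linear_injective_imp_surjective[OF linear_denom] by simp
qed

text \<open>On the imaginary axis \<open>|D(i w)|^2 - |N(i w)|^2 = 252 w^4 + 35 w^6\<close> for the numerator \<open>N\<close> and the
  denominator \<open>D\<close>. Off the axis what \<open>|D(z)|^2 - |N(z)|^2\<close> has beyond \<open>252 |z|^4 + 35 |z|^6\<close> is \<open>- 2 Re z\<close> times
  the Hermitian form in \<open>1, z, z^2\<close> with the positive definite matrix
  \<open>((144, -288, 60), (-288, 660, -162), (60, -162, 144))\<close>. Its Cholesky
  decomposition, with pivots 144, 84 and 98, yields the vectors \<open>p\<close>, \<open>q\<close> and \<open>L (L x)\<close>, and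
  \<open>- 2 Re z\<close> becomes \<open>- 2 (v \<bullet> L v)\<close>.\<close>

lemma denom_numer_identity:
  fixes x defines "p \<equiv> x - 2 *\<^sub>R L x + (5/12) *\<^sub>R L (L x)" and "q \<equiv> L x - (1/2) *\<^sub>R L (L x)"
  shows "(norm (denom x))\<^sup>2 - (norm (numer x))\<^sup>2 =
    252 * (norm (L (L x)))\<^sup>2 + 35 * (norm (L (L (L x))))\<^sup>2
    - 288 * (p \<bullet> L p) - 168 * (q \<bullet> L q) - 196 * (L (L x) \<bullet> L (L (L x)))"
proof -
  define b c d where "b = L x" and "c = L b" and "d = L c"
  have Lpq: "L p = b - 2 *\<^sub>R c + (5/12) *\<^sub>R d" "L q = c - (1/2) *\<^sub>R d"
    by (simp_all add: p_def q_def L_simps b_def c_def d_def)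
  show ?thesis
    unfolding Lpq denom_def numer_def unfolding p_def q_def b_def[symmetric] c_def[symmetric] d_def[symmetric]
    by (simp add: power2_norm_eq_inner inner_simps inner_commute algebra_simps)
qed

text \<open>\<open>L\<close> maps into the complement of its kernel and is injective there, so \<open>L \<circ> L\<close> is bounded below on
  that complement; the term \<open>252 * (norm (L (L x)))\<^sup>2\<close> of the identity thus dominates a fixed fraction
  of \<open>(norm (denom x))\<^sup>2\<close>.\<close>

lemma numer_contraction:
  "\<exists>\<rho><1. 0 \<le> \<rho> \<and> (\<forall>x\<in>kernel_perp. norm (numer x) \<le> \<rho> * norm (denom x))"
proof -
  have "bounded_linear (\<lambda>x. L (L x))"
    using linear_compose[OF lin lin] by (simp add: o_def linear_conv_bounded_linear)
  moreover have "\<forall>x\<in>kernel_perp. L (L x) = 0 \<longrightarrow> x = 0"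
    using kernel_Int_kernel_perp L_in_kernel_perp by blast
  ultimately obtain e where e: "e > 0" "\<And>x. x \<in> kernel_perp \<Longrightarrow> e * norm x \<le> norm (L (L x))"
    using injective_imp_isometric[OF closed_subspace[OF subspace_kernel_perp] subspace_kernel_perp] by blast
  obtain M where M: "M > 0" "\<And>x. norm (denom x) \<le> M * norm x"
    using linear_bounded_pos[OF linear_denom] by blast
  define c where "c = min 1 (252 * e\<^sup>2 / M\<^sup>2)"
  have c: "0 < c" "c \<le> 1" "c * M\<^sup>2 \<le> 252 * e\<^sup>2"
    using e(1) M(1) by (auto simp: c_def min_def field_simps)
  have "norm (numer x) \<le> sqrt (1 - c) * norm (denom x)" if "x \<in> kernel_perp" for x
  proof -
    have "c * (norm (denom x))\<^sup>2 \<le> c * (M * norm x)\<^sup>2"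
      using c M(2)[of x] by (intro mult_left_mono power_mono) auto
    also have "\<dots> = (c * M\<^sup>2) * (norm x)\<^sup>2" by (simp add: power_mult_distrib)
    also have "\<dots> \<le> 252 * e\<^sup>2 * (norm x)\<^sup>2" using c(3) by (intro mult_right_mono) auto
    also have "\<dots> = 252 * (e * norm x)\<^sup>2" by (simp add: power_mult_distrib)
    also have "\<dots> \<le> 252 * (norm (L (L x)))\<^sup>2"
      using e(2)[OF that] e(1) by (intro mult_left_mono power_mono) auto
    also have "\<dots> \<le> (norm (denom x))\<^sup>2 - (norm (numer x))\<^sup>2"
      unfolding denom_numer_identity
      using diss[of "x - 2 *\<^sub>R L x + (5/12) *\<^sub>R L (L x)"] diss[of "L x - (1/2) *\<^sub>R L (L x)"]
        diss[of "L (L x)"] zero_le_power2[of "norm (L (L (L x)))"] by linarith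
    finally have "(norm (numer x))\<^sup>2 \<le> (1 - c) * (norm (denom x))\<^sup>2"
      by (simp add: algebra_simps)
    then have "sqrt ((norm (numer x))\<^sup>2) \<le> sqrt ((1 - c) * (norm (denom x))\<^sup>2)"
      by (rule real_sqrt_le_mono)
    then show ?thesis by (simp add: real_sqrt_mult)
  qed
  moreover have "sqrt (1 - c) < 1" "0 \<le> sqrt (1 - c)" using c by auto
  ultimately show ?thesis by blast
qed

text \<open>Here \<open>u\<close>, \<open>v1\<close>, \<open>v2\<close>, \<open>v3\<close> are the deviations of the starting value, of the two inner stages and of
  the new value from a steady state, and \<open>r2\<close>, \<open>r3\<close> the nonlinear remainders. Multiplying the last
  equation by \<open>6 (1 - L) (2 - L)\<close> eliminates the inner stages.\<close>

lemma stages_combined: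
  assumes 1: "v1 = u + L v1"
    and 2: "v2 = u + (1/4) *\<^sub>R L (2 *\<^sub>R v2 + u - v1 + r2)"
    and 3: "v3 = u + (1/6) *\<^sub>R L (6 *\<^sub>R v3 + u - 5 *\<^sub>R v1 + 4 *\<^sub>R v2 + r3)"
  defines "b \<equiv> 2 *\<^sub>R r3 - L r3"
  shows "denom v3 = numer u + 2 *\<^sub>R L (L r2 - L (L r2)) + L (b - L b)"
proof -
  define f where "f x = x - L x" for x
  define h where "h x = 2 *\<^sub>R x - L x" for x
  note fh = f_def h_def L_simps
  have f1: "f v1 = u" using 1 by (simp add: f_def algebra_simps)
  have h2: "h v2 = 2 *\<^sub>R u + (1/2) *\<^sub>R L (u - v1 + r2)"
  proof -
    have "4 *\<^sub>R v2 = 4 *\<^sub>R u + L (2 *\<^sub>R v2 + u - v1 + r2)"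
      by (subst 2) (simp add: scaleR_add_right)
    then have "2 *\<^sub>R h v2 = 2 *\<^sub>R (2 *\<^sub>R u + (1/2) *\<^sub>R L (u - v1 + r2))"
      by (simp add: fh algebra_simps)
    then show ?thesis by simp
  qed
  have f3: "6 *\<^sub>R f v3 = 6 *\<^sub>R u + L (u - 5 *\<^sub>R v1 + 4 *\<^sub>R v2 + r3)"
  proof -
    have "6 *\<^sub>R v3 = 6 *\<^sub>R u + L (6 *\<^sub>R v3 + u - 5 *\<^sub>R v1 + 4 *\<^sub>R v2 + r3)"
      by (subst 3) (simp add: scaleR_add_right)
    then show ?thesis by (simp add: fh algebra_simps)
  qed
  have fhc: "f (h x) = h (f x)" "f (L x) = L (f x)" "h (L x) = L (h x)"
     "f (x + y) = f x + f y" "h (x + y) = h x + h y" "f (x - y) = f x - f y" "h (x - y) = h x - h y" 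
     "f (c *\<^sub>R x) = c *\<^sub>R f x" "h (c *\<^sub>R x) = c *\<^sub>R h x" for x y c
    by (simp_all add: fh algebra_simps)
  have "denom v3 = h (f (6 *\<^sub>R f v3))"
    by (rule vector_eq_innerI) (simp add: denom_def fh inner_simps algebra_simps)
  also have "\<dots> = 6 *\<^sub>R h (f u) + L (h (f u) - 5 *\<^sub>R h u + 4 *\<^sub>R f (h v2) + h (f r3))"
    unfolding f3 by (simp add: fhc f1)
  also have "f (h v2) = 2 *\<^sub>R f u + (1/2) *\<^sub>R L (f u - u + f r2)"
    unfolding h2 by (simp add: fhc f1)
  finally have v3: "denom v3 = 6 *\<^sub>R h (f u) + L (h (f u) - 5 *\<^sub>R h u
      + 4 *\<^sub>R (2 *\<^sub>R f u + (1/2) *\<^sub>R L (f u - u + f r2)) + h (f r3))" .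
  show ?thesis
    unfolding v3 by (rule vector_eq_innerI)
      (simp add: numer_def b_def fh inner_simps algebra_simps)
qed

text \<open>Remainders of relative size \<open>\<epsilon>\<close> first leave \<open>v2\<close> and \<open>v3\<close> bounded by multiples of \<open>norm u\<close>; they
  then contribute only \<open>O(\<epsilon>) * norm u\<close> to \<open>denom v3\<close>, which the gap between the contraction factor
  of \<open>R(L)\<close> and 1 absorbs. The bound on \<open>v2\<close> is a conclusion of its own, with \<open>r3\<close> still
  unrestricted, because the smallness of \<open>r3\<close> in the scheme depends on \<open>v2\<close> being small.\<close>

lemma perturbed_contraction:
  "\<exists>\<rho> C \<epsilon>. 0 \<le> \<rho> \<and> \<rho> < 1 \<and> 0 < C \<and> 0 < \<epsilon> \<and> (\<forall>u v1 v2 v3 r2 r3. u \<in> kernel_perp \<longrightarrow>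
     v1 = u + L v1 \<longrightarrow>
     v2 = u + (1/4) *\<^sub>R L (2 *\<^sub>R v2 + u - v1 + r2) \<longrightarrow>
     v3 = u + (1/6) *\<^sub>R L (6 *\<^sub>R v3 + u - 5 *\<^sub>R v1 + 4 *\<^sub>R v2 + r3) \<longrightarrow>
     norm r2 \<le> \<epsilon> * norm (v2 - v1) \<longrightarrow>
     norm v2 \<le> C * norm u \<and>
     (norm r3 \<le> \<epsilon> * norm (v3 - v1) \<longrightarrow> norm v3 \<le> \<rho> * norm u))"
proof -
  obtain \<rho> where \<rho>: "\<rho> < 1" "0 \<le> \<rho>" "\<And>x. x \<in> kernel_perp \<Longrightarrow> norm (numer x) \<le> \<rho> * norm (denom x)"
    using numer_contraction by blast
  obtain K where K: "K > 0" "\<And>x. norm (L x) \<le> K * norm x"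
    using linear_bounded_pos[OF lin] by blast
  \<comment> \<open>\<open>C\<close> and \<open>C3\<close> bound \<open>v2\<close> and \<open>v3\<close>, and \<open>E * \<epsilon>\<close> bounds the remainder terms in \<open>denom v3\<close>, all
    relative to \<open>norm u\<close>. The first part of \<open>\<epsilon>\<close> serves the bounds on \<open>v2\<close> and \<open>v3\<close>; the second makes
    the remainder, after dividing by the constant 12 of \<open>denom_bound\<close>, at most half the gap \<open>1 - \<rho>\<close>.\<close>
  define C where "C = 3 + K"
  define C3 where "C3 = 2 + K * (5 + K)"
  define E where "E = 2 * K\<^sup>2 * (1 + K) * (1 + C) + K * (1 + K) * (2 + K) * (1 + C3)"
  define \<epsilon> where "\<epsilon> = min (2 / K) (6 * (1 - \<rho>) / E)"
  have pos: "0 < C" "0 < C3" "0 < E"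
    using K(1) by (auto simp: C_def C3_def E_def intro!: add_pos_pos mult_pos_pos)
  have \<epsilon>: "0 < \<epsilon>" "K * \<epsilon> \<le> 2" "E * \<epsilon> \<le> 6 * (1 - \<rho>)"
    using K(1) pos \<rho>(1) by (auto simp: \<epsilon>_def min_def field_simps)
  have bound_f: "norm (L (x - L x)) \<le> K * (1 + K) * norm x" for x
  proof -
    have "norm (L (x - L x)) \<le> K * norm (x - L x)" by (rule K)
    also have "\<dots> \<le> K * (norm x + K * norm x)"
      using K(1) norm_triangle_ineq4[of x "L x"] K(2)[of x] by (intro mult_left_mono) auto
    finally show ?thesis by (simp add: algebra_simps)
  qed
  have absorb: "K * norm r \<le> 2 * n" if "norm r \<le> \<epsilon> * n" "0 \<le> n" for r n
  proof -
    have "K * norm r \<le> (K * \<epsilon>) * n" using that(1) K(1) by simp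
    also have "\<dots> \<le> 2 * n" using \<epsilon>(2) that(2) by (intro mult_right_mono) auto
    finally show ?thesis .
  qed
  have "norm v2 \<le> C * norm u \<and>
     (norm r3 \<le> \<epsilon> * norm (v3 - v1) \<longrightarrow> norm v3 \<le> (1 + \<rho>) / 2 * norm u)"
    if u: "u \<in> kernel_perp" and 1: "v1 = u + L v1"
      and 2: "v2 = u + (1/4) *\<^sub>R L (2 *\<^sub>R v2 + u - v1 + r2)"
      and 3: "v3 = u + (1/6) *\<^sub>R L (6 *\<^sub>R v3 + u - 5 *\<^sub>R v1 + 4 *\<^sub>R v2 + r3)"
      and r2: "norm r2 \<le> \<epsilon> * norm (v2 - v1)"
    for u v1 v2 v3 r2 r3
  proof -
    have v1: "norm v1 \<le> norm u" using 1 by (rule implicit_euler_bound)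
    have r2': "norm r2 \<le> \<epsilon> * (norm v2 + norm u)"
      using r2 norm_triangle_ineq4[of v2 v1] v1 \<epsilon>(1)
      by (smt (verit, best) mult_left_mono)
    have v2: "norm v2 \<le> C * norm u"
    proof -
      have "4 *\<^sub>R v2 = 4 *\<^sub>R u + L (2 *\<^sub>R v2 + u - v1 + r2)"
        by (subst 2) (simp add: scaleR_add_right)
      then have "4 *\<^sub>R v2 - 2 *\<^sub>R L v2 = 4 *\<^sub>R u + L (u - v1 + r2)"
        by (simp add: L_simps algebra_simps)
      moreover have "4 *\<^sub>R v2 - 2 *\<^sub>R L v2 = 2 *\<^sub>R (2 *\<^sub>R v2 - L v2)"
        by (simp add: scaleR_diff_right)
      ultimately have "2 * norm (2 *\<^sub>R v2 - L v2) = norm (4 *\<^sub>R u + L (u - v1 + r2))"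
        by (metis abs_numeral norm_scaleR)
      also have "\<dots> \<le> 4 * norm u + norm (L (u - v1 + r2))"
        using norm_triangle_ineq[of "4 *\<^sub>R u" "L (u - v1 + r2)"] by simp
      also have "norm (L (u - v1 + r2)) \<le> K * (2 * norm u + norm r2)"
      proof -
        have "norm (u - v1 + r2) \<le> 2 * norm u + norm r2"
          using norm_triangle_ineq[of "u - v1" r2] norm_triangle_ineq4[of u v1] v1 by linarith
        then show ?thesis using K by (smt (verit, best) mult_left_mono)
      qed
      finally have "2 * norm (2 *\<^sub>R v2 - L v2) \<le> 4 * norm u + K * (2 * norm u + norm r2)" by simp
      moreover have "K * norm r2 \<le> 2 * (norm v2 + norm u)" by (rule absorb[OF r2']) simp
      moreover have "2 * norm v2 \<le> norm (2 *\<^sub>R v2 - L v2)" by (rule resolvent_bound) simp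
      ultimately show ?thesis by (simp add: C_def algebra_simps)
    qed
    have "norm v3 \<le> (1 + \<rho>) / 2 * norm u" if r3: "norm r3 \<le> \<epsilon> * norm (v3 - v1)"
    proof -
      have r3': "norm r3 \<le> \<epsilon> * (norm v3 + norm u)"
        using r3 norm_triangle_ineq4[of v3 v1] v1 \<epsilon>(1)
        by (smt (verit, best) mult_left_mono)
      have v3: "norm v3 \<le> C3 * norm u"
      proof -
        have "6 *\<^sub>R v3 = 6 *\<^sub>R u + L (6 *\<^sub>R v3 + u - 5 *\<^sub>R v1 + 4 *\<^sub>R v2 + r3)"
          by (subst 3) (simp add: scaleR_add_right)
        then have "6 *\<^sub>R (1 *\<^sub>R v3 - L v3) = 6 *\<^sub>R u + L (u - 5 *\<^sub>R v1 + 4 *\<^sub>R v2 + r3)"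
          by (simp add: L_simps algebra_simps)
        then have "6 * norm (1 *\<^sub>R v3 - L v3) = norm (6 *\<^sub>R u + L (u - 5 *\<^sub>R v1 + 4 *\<^sub>R v2 + r3))"
          by (metis abs_numeral norm_scaleR)
        also have "\<dots> \<le> 6 * norm u + norm (L (u - 5 *\<^sub>R v1 + 4 *\<^sub>R v2 + r3))"
          using norm_triangle_ineq[of "6 *\<^sub>R u"] by (metis abs_numeral norm_scaleR)
        also have "norm (L (u - 5 *\<^sub>R v1 + 4 *\<^sub>R v2 + r3)) \<le> K * (6 * norm u + 4 * (C * norm u) + norm r3)"
        proof -
          have "norm (u - 5 *\<^sub>R v1 + 4 *\<^sub>R v2 + r3) \<le> norm u + norm (5 *\<^sub>R v1) + norm (4 *\<^sub>R v2) + norm r3"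
            by (meson add_mono norm_triangle_ineq norm_triangle_ineq4 order_refl order_trans)
          also have "\<dots> \<le> 6 * norm u + 4 * (C * norm u) + norm r3" using v1 v2 by simp
          finally show ?thesis using K by (smt (verit, best) mult_left_mono)
        qed
        finally have "6 * norm (1 *\<^sub>R v3 - L v3)
          \<le> 6 * norm u + K * (6 * norm u + 4 * (C * norm u) + norm r3)" by simp
        moreover have "K * norm r3 \<le> 2 * (norm v3 + norm u)" by (rule absorb[OF r3']) simp
        moreover have "1 * norm v3 \<le> norm (1 *\<^sub>R v3 - L v3)" by (rule resolvent_bound) simp
        moreover have "0 \<le> K * norm u" using K(1) by simp
        ultimately have "4 * norm v3 \<le> 4 * (C3 * norm u)" by (simp add: C_def C3_def algebra_simps)
        then show ?thesis by simp
      qed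
      have "norm (2 *\<^sub>R L (L r2 - L (L r2))) \<le> 2 * K\<^sup>2 * (1 + K) * norm r2"
      proof -
        have "norm (L (L r2 - L (L r2))) \<le> K * (1 + K) * (K * norm r2)"
          using bound_f[of "L r2"] K(2)[of r2] K(1) by (smt (verit, best) mult_left_mono mult_pos_pos)
        then show ?thesis by (simp add: power2_eq_square algebra_simps)
      qed
      also have "\<dots> \<le> 2 * K\<^sup>2 * (1 + K) * (\<epsilon> * ((1 + C) * norm u))"
      proof -
        have "norm r2 \<le> \<epsilon> * ((1 + C) * norm u)"
          using order_trans[OF r2' mult_left_mono[of "norm v2 + norm u" "(1 + C) * norm u" \<epsilon>]] v2 \<epsilon>(1)
          by (simp add: algebra_simps)
        then show ?thesis using K(1) by (intro mult_left_mono) auto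
      qed
      finally have e2: "norm (2 *\<^sub>R L (L r2 - L (L r2))) \<le> 2 * K\<^sup>2 * (1 + K) * (\<epsilon> * ((1 + C) * norm u))" .
      define b where "b = 2 *\<^sub>R r3 - L r3"
      have "norm (L (b - L b)) \<le> K * (1 + K) * (2 + K) * norm r3"
      proof -
        have "norm b \<le> (2 + K) * norm r3"
          using norm_triangle_ineq4[of "2 *\<^sub>R r3" "L r3"] K(2)[of r3] by (simp add: b_def algebra_simps)
        then have "K * (1 + K) * norm b \<le> K * (1 + K) * ((2 + K) * norm r3)"
          using K(1) by (intro mult_left_mono) auto
        with bound_f[of b] show ?thesis by (simp add: mult.assoc)
      qed
      also have "\<dots> \<le> K * (1 + K) * (2 + K) * (\<epsilon> * ((1 + C3) * norm u))"
      proof -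
        have "norm r3 \<le> \<epsilon> * ((1 + C3) * norm u)"
          using order_trans[OF r3' mult_left_mono[of "norm v3 + norm u" "(1 + C3) * norm u" \<epsilon>]] v3 \<epsilon>(1)
          by (simp add: algebra_simps)
        then show ?thesis using K(1) by (intro mult_left_mono) auto
      qed
      finally have e3: "norm (L (b - L b)) \<le> K * (1 + K) * (2 + K) * (\<epsilon> * ((1 + C3) * norm u))" .
      \<comment> \<open>\<open>numer x\<close> is \<open>R(L) u\<close>, the image of \<open>u\<close> under the linearised step\<close>
      obtain x where x: "denom x = u" using surj_denom by (metis surjD)
      have xW: "x \<in> kernel_perp"
      proof -
        have "x = (1/12) *\<^sub>R (u - L (-30 *\<^sub>R x + 24 *\<^sub>R L x - 6 *\<^sub>R L (L x)))"
          unfolding x[symmetric] denom_def by (simp add: L_simps)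
        then show ?thesis
          by (metis u L_in_kernel_perp subspace_kernel_perp subspace_diff subspace_scale)
      qed
      have "denom (v3 - numer x) = 2 *\<^sub>R L (L r2 - L (L r2)) + L (b - L b)"
      proof -
        have "denom (numer x) = numer u"
          unfolding x[symmetric] denom_def numer_def by (simp add: L_simps algebra_simps)
        then show ?thesis
          using stages_combined[OF 1 2 3] by (simp add: linear_diff[OF linear_denom] b_def)
      qed
      then have "12 * norm (v3 - numer x) \<le> norm (2 *\<^sub>R L (L r2 - L (L r2)) + L (b - L b))"
        using denom_bound[of "v3 - numer x"] by simp
      also have "\<dots> \<le> (E * \<epsilon>) * norm u"
        using norm_triangle_ineq[of "2 *\<^sub>R L (L r2 - L (L r2))" "L (b - L b)"] e2 e3
        by (simp add: E_def algebra_simps)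
      also have "\<dots> \<le> (6 * (1 - \<rho>)) * norm u" using \<epsilon>(3) by (intro mult_right_mono) auto
      finally have "norm (v3 - numer x) \<le> (1 - \<rho>) / 2 * norm u" by (simp add: algebra_simps)
      moreover have "norm (numer x) \<le> \<rho> * norm u" using \<rho>(3)[OF xW] by (simp add: x)
      moreover have "norm v3 \<le> norm (v3 - numer x) + norm (numer x)"
        using norm_triangle_ineq[of "v3 - numer x" "numer x"] by simp
      ultimately show ?thesis by (simp add: field_simps)
    qed
    with v2 show ?thesis by blast
  qed
  moreover have "(1 + \<rho>) / 2 < 1" "0 \<le> (1 + \<rho>) / 2" using \<rho> by auto
  ultimately show ?thesis using pos(1) \<epsilon>(1) by blast
qed

end

section \<open>The scheme in coordinates weighted by a steady state\<close>

text \<open>Componentwise \<open>w x / y1 = x + c (w - y1) + (w - y1) (x - c y1) / y1\<close> for every \<open>c\<close>. At a steady state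
  all stages agree, and the weight vector \<open>x\<close> of the second and third stage is 2 and 6 times
  that common value; with this \<open>c\<close> the last term is of second order.\<close>

lemma patankar_product_expansion:
  fixes A :: "real^'n^'n"
  assumes "positive_vec y1"
  shows "(A ** diag_matrix w ** matrix_inv (diag_matrix y1)) *v x =
    A *v (x + c *\<^sub>R (w - y1) + (\<chi> i. (w - y1) $ i * ((x - c *\<^sub>R y1) $ i / y1 $ i)))"
proof -
  have nz: "y1 $ i \<noteq> 0" for i
    using assms unfolding positive_vec_def by (metis less_irrefl)
  show ?thesis
    unfolding patankar_product[OF assms] diag_matrix_mult_vec
    by (rule arg_cong[where f = "\<lambda>v. A *v v"]) (simp add: vec_eq_iff nz field_simps)
qed

locale positive_steady_state =
  fixes A :: "real^'n^'n" and ystar :: "real^'n" and dt :: real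
  assumes A: "standing_assumptions A" and pos: "positive_vec ystar"
    and steady: "A *v ystar = 0" and dt: "0 < dt"
begin

definition s :: "'n \<Rightarrow> real" where "s i = sqrt (ystar $ i)"
definition scale :: "real^'n \<Rightarrow> real^'n" where "scale v = (\<chi> i. v $ i / s i)"
definition unscale :: "real^'n \<Rightarrow> real^'n" where "unscale w = (\<chi> i. s i * w $ i)"
definition L :: "real^'n \<Rightarrow> real^'n" where "L w = scale (dt *\<^sub>R (A *v unscale w))"

lemma s_pos: "0 < s i" and s_sq: "s i * s i = ystar $ i"
  using pos by (auto simp: s_def positive_vec_def less_imp_le)

lemma s_nz [simp]: "s i \<noteq> 0" using s_pos[of i] by simp

lemma unscale_scale [simp]: "unscale (scale v) = v" and scale_unscale [simp]: "scale (unscale w) = w"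
  by (simp_all add: scale_def unscale_def vec_eq_iff)

lemma linear_scale: "linear scale" and linear_unscale: "linear unscale"
  by (auto intro!: linearI simp: scale_def unscale_def vec_eq_iff field_simps)

lemmas scale_simps = linear_add[OF linear_scale] linear_diff[OF linear_scale]
  linear_cmul[OF linear_scale] linear_0[OF linear_scale]

lemma linear_L: "linear L"
  unfolding L_def
  by (intro linearI) (simp_all add: linear_add[OF linear_unscale] linear_cmul[OF linear_unscale]
      matrix_vector_right_distrib matrix_vector_mult_scaleR scale_simps scaleR_add_right)

lemma L_scale: "L (scale v) = scale (dt *\<^sub>R (A *v v))"
  by (simp add: L_def)

text \<open>The weights turn the quadratic form of \<open>A\<close> into that of the matrix \<open>A $ i $ j * ystar $ j\<close>, whose
  row sums vanish because \<open>ystar\<close> is steady and whose column sums vanish because the total mass is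
  conserved; hence it is a negative combination of the squares \<open>(w i - w j)\<^sup>2\<close>.\<close>

lemma dissipative_L: "x \<bullet> L x \<le> 0"
proof -
  define w where "w i = x $ i / s i" for i
  have x: "x $ i = s i * w i" for i by (simp add: w_def)
  have row: "(\<Sum>j\<in>UNIV. A $ i $ j * ystar $ j) = 0" for i
    using steady by (simp add: matrix_vector_mult_def vec_eq_iff)
  have col: "(\<Sum>i\<in>UNIV. A $ i $ j) = 0" for j
    using A by (simp add: standing_assumptions_def mat_kernel_def matrix_vector_mult_def
        transpose_def vec_eq_iff)
  have "0 \<le> (\<Sum>i\<in>UNIV. \<Sum>j\<in>UNIV. A $ i $ j * ystar $ j * (w i - w j)\<^sup>2)"
  proof (intro sum_nonneg)
    fix i j show "0 \<le> A $ i $ j * ystar $ j * (w i - w j)\<^sup>2"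
      using A pos by (cases "i = j") (auto simp: standing_assumptions_def positive_vec_def less_imp_le)
  qed
  also have "\<dots> = (\<Sum>i\<in>UNIV. (w i)\<^sup>2 * (\<Sum>j\<in>UNIV. A $ i $ j * ystar $ j))
      + (\<Sum>i\<in>UNIV. \<Sum>j\<in>UNIV. A $ i $ j * ystar $ j * (w j)\<^sup>2)
      - 2 * (\<Sum>i\<in>UNIV. \<Sum>j\<in>UNIV. A $ i $ j * ystar $ j * w i * w j)"
    by (simp add: power2_eq_square algebra_simps sum.distrib sum_subtractf sum_distrib_left)
  also have "(\<Sum>i\<in>UNIV. \<Sum>j\<in>UNIV. A $ i $ j * ystar $ j * (w j)\<^sup>2)
      = (\<Sum>j\<in>UNIV. ystar $ j * (w j)\<^sup>2 * (\<Sum>i\<in>UNIV. A $ i $ j))"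
    by (subst sum.swap) (simp add: sum_distrib_left mult_ac)
  finally have nonpos: "(\<Sum>i\<in>UNIV. \<Sum>j\<in>UNIV. A $ i $ j * ystar $ j * w i * w j) \<le> 0"
    by (simp add: row col)
  have "x \<bullet> L x = (\<Sum>i\<in>UNIV. w i * (dt * (A *v unscale x) $ i))"
    unfolding inner_vec_def by (rule sum.cong) (simp_all add: L_def scale_def w_def)
  also have "\<dots> = dt * (\<Sum>i\<in>UNIV. \<Sum>j\<in>UNIV. A $ i $ j * ystar $ j * w i * w j)"
    by (simp add: unscale_def matrix_vector_mult_def x sum_distrib_left mult_ac flip: s_sq)
  finally have "x \<bullet> L x = dt * (\<Sum>i\<in>UNIV. \<Sum>j\<in>UNIV. A $ i $ j * ystar $ j * w i * w j)" .
  then show ?thesis using nonpos dt by (simp add: mult_nonneg_nonpos)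
qed

sublocale dissipative L
  by (intro dissipative.intro linear_L dissipative_L)

lemma kernel_L: "L k = 0 \<longleftrightarrow> A *v unscale k = 0"
proof
  assume "L k = 0"
  then have "unscale (L k) = 0" by (simp add: linear_0[OF linear_unscale])
  then show "A *v unscale k = 0" using dt by (simp add: L_def)
qed (simp add: L_def scale_simps)

lemma component_bound: "\<bar>v $ i\<bar> \<le> s i * norm (scale v)"
  using component_le_norm_cart[of "scale v" i] s_pos[of i]
  by (simp add: scale_def abs_divide field_simps)

lemma componentwise_product_bound:
  assumes "\<And>i. \<bar>e i\<bar> \<le> \<epsilon>"
  shows "norm (scale (\<chi> i. v $ i * e i)) \<le> \<epsilon> * norm (scale v)"
proof -
  have "0 \<le> \<epsilon>" using assms by (metis abs_ge_zero order_trans)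
  have "norm (scale (\<chi> i. v $ i * e i)) \<le> norm (\<epsilon> *\<^sub>R scale v)"
  proof (rule norm_le_componentwise_cart)
    fix i
    have "\<bar>e i\<bar> * \<bar>scale v $ i\<bar> \<le> \<epsilon> * \<bar>scale v $ i\<bar>" using assms by (rule mult_right_mono) simp
    then show "norm (scale (\<chi> i. v $ i * e i) $ i) \<le> norm ((\<epsilon> *\<^sub>R scale v) $ i)"
      using \<open>0 \<le> \<epsilon>\<close> by (simp add: scale_def abs_mult mult_ac)
  qed
  then show ?thesis using \<open>0 \<le> \<epsilon>\<close> by simp
qed

text \<open>The linearisation \<open>R(L)\<close> is the same at every steady state \<open>z\<close>, so one contraction factor serves all
  \<open>z\<close> near \<open>ystar\<close>. Membership in the complement of the kernel is preserved because the
  step changes the deviation by an element of the range of \<open>L\<close>.\<close>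

lemma step_contraction:
  "\<exists>\<rho> \<delta>. 0 \<le> \<rho> \<and> \<rho> < 1 \<and> 0 < \<delta> \<and> (\<forall>z y. A *v z = 0 \<longrightarrow> norm (scale (z - ystar)) < \<delta> \<longrightarrow>
     scale (y - z) \<in> kernel_perp \<longrightarrow> norm (scale (y - z)) < \<delta> \<longrightarrow>
     scale (mprk32 A dt y - z) \<in> kernel_perp \<and> norm (scale (mprk32 A dt y - z)) \<le> \<rho> * norm (scale (y - z)))"
proof -
  obtain \<rho> C \<epsilon> where \<rho>: "0 \<le> \<rho>" "\<rho> < 1" and C: "0 < C" and \<epsilon>: "0 < \<epsilon>" and
    contr: "\<And>u v1 v2 v3 r2 r3. u \<in> kernel_perp \<Longrightarrow> v1 = u + L v1 \<Longrightarrow>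
     v2 = u + (1/4) *\<^sub>R L (2 *\<^sub>R v2 + u - v1 + r2) \<Longrightarrow>
     v3 = u + (1/6) *\<^sub>R L (6 *\<^sub>R v3 + u - 5 *\<^sub>R v1 + 4 *\<^sub>R v2 + r3) \<Longrightarrow>
     norm r2 \<le> \<epsilon> * norm (v2 - v1) \<Longrightarrow>
     norm v2 \<le> C * norm u \<and>
     (norm r3 \<le> \<epsilon> * norm (v3 - v1) \<longrightarrow> norm v3 \<le> \<rho> * norm u)"
    using perturbed_contraction by metis
  define m where "m = Min (range s)"
  have m: "0 < m" "m \<le> s i" for i
    using s_pos by (auto simp: m_def)
  \<comment> \<open>\<open>m / 4\<close> keeps the components of \<open>y\<close> and of the first stage above half of those of \<open>ystar\<close>; the
    second bound makes the quotients \<open>(x - c y1) / y1\<close> in the remainders at most \<open>\<epsilon>\<close>, since the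
    weighted norm of \<open>x - c y1\<close> will be at most \<open>(6 + 4 * C) * \<delta>\<close>.\<close>
  define \<delta> where "\<delta> = min (m / 4) (\<epsilon> * m / (12 + 8 * C))"
  have \<delta>: "0 < \<delta>" "4 * \<delta> \<le> m"
    using m(1) \<epsilon> C by (auto simp: \<delta>_def)
  have "\<delta> * (12 + 8 * C) \<le> \<epsilon> * m"
    using C by (subst pos_le_divide_eq[symmetric]) (auto simp: \<delta>_def)
  then have \<delta>C: "(6 + 4 * C) * \<delta> \<le> \<epsilon> * m / 2" by (simp add: algebra_simps)
  have "scale (mprk32 A dt y - z) \<in> kernel_perp \<and> norm (scale (mprk32 A dt y - z)) \<le> \<rho> * norm (scale (y - z))"
    if z: "A *v z = 0" "norm (scale (z - ystar)) < \<delta>"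
      and u: "scale (y - z) \<in> kernel_perp" "norm (scale (y - z)) < \<delta>" for y z
  proof -
    have near: "ystar $ i / 2 \<le> x $ i" if "norm (scale (x - z)) \<le> norm (scale (y - z))" for x i
    proof -
      have "norm (scale (x - ystar)) \<le> 2 * \<delta>"
      proof -
        have "scale (x - ystar) = scale (x - z) + scale (z - ystar)" by (simp add: scale_simps)
        then show ?thesis
          using norm_triangle_ineq[of "scale (x - z)" "scale (z - ystar)"] z u that by simp
      qed
      also have "\<dots> \<le> s i / 2" using \<delta>(2) m(2)[of i] by simp
      finally have "s i * norm (scale (x - ystar)) \<le> s i * (s i / 2)"
        using s_pos[of i] by (intro mult_left_mono) auto
      also have "\<dots> = ystar $ i / 2" by (simp add: s_sq)
      finally show ?thesis using component_bound[of "x - ystar" i] by simp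
    qed
    have "positive_vec y"
      using near[of y] pos by (auto simp: positive_vec_def) (smt (verit) field_sum_of_halves)
    note stages = mprk32_stages[OF A dt this]
    define y1 where "y1 = mprk32_stage1 A dt y"
    define y2 where "y2 = mprk32_stage2 A dt y y1"
    define y3 where "y3 = mprk32 A dt y"
    define r2 where "r2 = (\<chi> i. (y2 - y1) $ i * ((y + y1 - 2 *\<^sub>R y1) $ i / y1 $ i))"
    define r3 where "r3 = (\<chi> i. (y3 - y1) $ i * ((y + y1 + 4 *\<^sub>R y2 - 6 *\<^sub>R y1) $ i / y1 $ i))"
    have p1: "positive_vec y1" using stages(3) by (simp add: y1_def)
    have e1: "y1 = y + dt *\<^sub>R (A *v y1)" using stages(2) by (simp add: y1_def)
    have e2: "y2 = y + (dt / 4) *\<^sub>R (A *v (y + y1 + 2 *\<^sub>R (y2 - y1) + r2))"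
      using stages(5) unfolding y1_def[symmetric] y2_def[symmetric]
        patankar_product_expansion[OF p1, where c = 2] r2_def .
    have e3: "y3 = y + (dt / 6) *\<^sub>R (A *v (y + y1 + 4 *\<^sub>R y2 + 6 *\<^sub>R (y3 - y1) + r3))"
      using stages(8) unfolding y1_def[symmetric] y2_def[symmetric] y3_def[symmetric]
        patankar_product_expansion[OF p1, where c = 6] r3_def .
    define u v1 v2 v3 where "u = scale (y - z)" and "v1 = scale (y1 - z)" and "v2 = scale (y2 - z)"
      and "v3 = scale (y3 - z)"
    note v_defs = u_def v1_def v2_def v3_def
    \<comment> \<open>\<open>A\<close> annihilates \<open>z\<close>, so the stage equations carry over to the deviations from \<open>z\<close>.\<close>
    have Lz: "L (scale (v - c *\<^sub>R z)) = L (scale v)" for v c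
      by (simp add: L_scale matrix_vector_mult_diff_distrib matrix_vector_mult_scaleR z)
    have shift: "scale (w - z) = u + a *\<^sub>R L x"
      if "w = y + (dt * a) *\<^sub>R (A *v v)" "x = scale (v - c *\<^sub>R z)" for w a v c x
      unfolding that(2) Lz u_def
      by (subst that(1)) (simp add: L_scale scale_simps mult.commute)
    have s1: "v1 = u + L v1"
      using shift[of y1 1 y1 v1 1] e1 by (simp add: v_defs)
    have x2: "2 *\<^sub>R v2 + u - v1 + scale r2 = scale (y + y1 + 2 *\<^sub>R (y2 - y1) + r2 - 2 *\<^sub>R z)"
      by (rule vector_eq_innerI) (simp add: v_defs scale_simps inner_simps algebra_simps)
    have s2: "v2 = u + (1/4) *\<^sub>R L (2 *\<^sub>R v2 + u - v1 + scale r2)"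
      by (rule shift[of y2 "1/4", OF _ x2, folded v2_def]) (use e2 in simp)
    have x3: "6 *\<^sub>R v3 + u - 5 *\<^sub>R v1 + 4 *\<^sub>R v2 + scale r3
        = scale (y + y1 + 4 *\<^sub>R y2 + 6 *\<^sub>R (y3 - y1) + r3 - 6 *\<^sub>R z)"
      by (rule vector_eq_innerI) (simp add: v_defs scale_simps inner_simps algebra_simps)
    have s3: "v3 = u + (1/6) *\<^sub>R L (6 *\<^sub>R v3 + u - 5 *\<^sub>R v1 + 4 *\<^sub>R v2 + scale r3)"
      by (rule shift[of y3 "1/6", OF _ x3, folded v3_def]) (use e3 in simp)
    have n1: "norm v1 \<le> norm u" using s1 by (rule implicit_euler_bound)
    have small: "\<bar>x $ i / y1 $ i\<bar> \<le> \<epsilon>" if "norm (scale x) \<le> (6 + 4 * C) * \<delta>" for x i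
    proof -
      have y1i: "ystar $ i / 2 \<le> y1 $ i" using near[of y1 i] n1 by (simp add: v_defs)
      have "\<bar>x $ i\<bar> \<le> s i * ((6 + 4 * C) * \<delta>)"
        using component_bound[of x i] that s_pos[of i] by (smt (verit) mult_left_mono)
      also have "\<dots> \<le> s i * (\<epsilon> * m / 2)" using \<delta>C s_pos[of i] by (intro mult_left_mono) auto
      also have "\<dots> \<le> s i * (\<epsilon> * s i / 2)" using m(2)[of i] \<epsilon> s_pos[of i] by (intro mult_left_mono) auto
      also have "\<dots> = \<epsilon> * (ystar $ i / 2)" by (simp flip: s_sq)
      also have "\<dots> \<le> \<epsilon> * y1 $ i" using y1i \<epsilon> by (intro mult_left_mono) auto
      finally show ?thesis using p1 by (simp add: positive_vec_def abs_divide pos_divide_le_eq abs_of_pos)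
    qed
    have r2: "norm (scale r2) \<le> \<epsilon> * norm (v2 - v1)"
    proof -
      have "norm (scale (y + y1 - 2 *\<^sub>R y1)) \<le> (6 + 4 * C) * \<delta>"
      proof -
        have "scale (y + y1 - 2 *\<^sub>R y1) = u - v1"
          by (simp add: v_defs scaleR_2 flip: linear_diff[OF linear_scale])
        moreover have "norm (u - v1) \<le> 2 * \<delta>" using norm_triangle_ineq4[of u v1] n1 u by (simp add: u_def)
        moreover have "2 * \<delta> \<le> (6 + 4 * C) * \<delta>" using \<delta>(1) C by (intro mult_right_mono) auto
        ultimately show ?thesis by simp
      qed
      then have "norm (scale r2) \<le> \<epsilon> * norm (scale (y2 - y1))"
        unfolding r2_def by (intro componentwise_product_bound small)
      then show ?thesis by (simp add: v_defs scale_simps)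
    qed
    have n2: "norm v2 \<le> C * norm u"
      using contr[OF u(1)[folded u_def] s1 s2 s3 r2] by blast
    have r3: "norm (scale r3) \<le> \<epsilon> * norm (v3 - v1)"
    proof -
      have "norm (scale (y + y1 + 4 *\<^sub>R y2 - 6 *\<^sub>R y1)) \<le> (6 + 4 * C) * \<delta>"
      proof -
        have "scale (y + y1 + 4 *\<^sub>R y2 - 6 *\<^sub>R y1) = u + 4 *\<^sub>R v2 - 5 *\<^sub>R v1"
          by (rule vector_eq_innerI) (simp add: v_defs scale_simps inner_simps algebra_simps)
        moreover have "norm (u + 4 *\<^sub>R v2 - 5 *\<^sub>R v1) \<le> norm u + norm (4 *\<^sub>R v2) + norm (5 *\<^sub>R v1)"
          by (meson add_mono norm_triangle_ineq norm_triangle_ineq4 order_refl order_trans)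
        moreover have "\<dots> \<le> (6 + 4 * C) * norm u" using n1 n2 by (simp add: algebra_simps)
        moreover have "\<dots> \<le> (6 + 4 * C) * \<delta>" using u(2) C by (intro mult_left_mono) (auto simp: u_def)
        ultimately show ?thesis by simp
      qed
      then have "norm (scale r3) \<le> \<epsilon> * norm (scale (y3 - y1))"
        unfolding r3_def by (intro componentwise_product_bound small)
      then show ?thesis by (simp add: v_defs scale_simps)
    qed
    have "norm v3 \<le> \<rho> * norm u"
      using contr[OF u(1)[folded u_def] s1 s2 s3 r2] r3 by blast
    moreover have "v3 \<in> kernel_perp"
      using s3 u(1) by (metis u_def L_in_kernel_perp subspace_kernel_perp subspace_add subspace_scale)
    ultimately show ?thesis by (simp add: v_defs y3_def)
  qed
  then show ?thesis using \<rho> \<delta>(1) by blast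
qed

section \<open>Convergence of the iterates\<close>

lemma iterates_contract:
  "\<exists>\<rho> \<delta>. 0 \<le> \<rho> \<and> \<rho> < 1 \<and> 0 < \<delta> \<and> (\<forall>z y. A *v z = 0 \<longrightarrow> norm (scale (z - ystar)) < \<delta> \<longrightarrow>
     scale (y - z) \<in> kernel_perp \<longrightarrow> norm (scale (y - z)) < \<delta> \<longrightarrow>
     (\<forall>n. norm (scale ((mprk32 A dt ^^ n) y - z)) \<le> \<rho> ^ n * norm (scale (y - z))))"
proof -
  obtain \<rho> \<delta> where \<rho>: "0 \<le> \<rho>" "\<rho> < 1" and \<delta>: "0 < \<delta>" and
    step: "\<And>z y. A *v z = 0 \<Longrightarrow> norm (scale (z - ystar)) < \<delta> \<Longrightarrow>
     scale (y - z) \<in> kernel_perp \<Longrightarrow> norm (scale (y - z)) < \<delta> \<Longrightarrow>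
     scale (mprk32 A dt y - z) \<in> kernel_perp \<and> norm (scale (mprk32 A dt y - z)) \<le> \<rho> * norm (scale (y - z))"
    using step_contraction by metis
  have "scale ((mprk32 A dt ^^ n) y - z) \<in> kernel_perp \<and>
      norm (scale ((mprk32 A dt ^^ n) y - z)) \<le> \<rho> ^ n * norm (scale (y - z))"
    if "A *v z = 0" "norm (scale (z - ystar)) < \<delta>"
      and u: "scale (y - z) \<in> kernel_perp" "norm (scale (y - z)) < \<delta>" for y z n
  proof (induction n)
    case (Suc n)
    have "\<rho> ^ n * norm (scale (y - z)) \<le> norm (scale (y - z))"
      using \<rho> by (simp add: mult_left_le_one_le power_le_one)
    with Suc u have "norm (scale ((mprk32 A dt ^^ n) y - z)) < \<delta>" by linarith
    from step[OF that(1,2) _ this] Suc have "scale ((mprk32 A dt ^^ Suc n) y - z) \<in> kernel_perp"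
      "norm (scale ((mprk32 A dt ^^ Suc n) y - z)) \<le> \<rho> * norm (scale ((mprk32 A dt ^^ n) y - z))"
      by auto
    moreover have "\<rho> * norm (scale ((mprk32 A dt ^^ n) y - z)) \<le> \<rho> ^ Suc n * norm (scale (y - z))"
      using mult_left_mono[OF conjunct2[OF Suc] \<rho>(1)] by (simp add: mult_ac)
    ultimately show ?case by linarith
  qed (use u in auto)
  then show ?thesis using \<rho> \<delta> by blast
qed

text \<open>For \<open>y\<close> near \<open>ystar\<close>, \<open>z\<close> is the limit of the iterates: the projection of \<open>y\<close> onto the steady states that is
  orthogonal in the weighted inner product. Orthogonality gives the two norm bounds.\<close>

lemma steady_state_decomposition:
  obtains z where "A *v z = 0" "scale (y - z) \<in> kernel_perp"
    "norm (scale (z - ystar)) \<le> norm (scale (y - ystar))"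
    "norm (scale (y - z)) \<le> norm (scale (y - ystar))"
proof -
  have sub: "subspace {k. L k = 0}" by (rule linear_subspace_kernel[OF linear_L])
  obtain k w where k: "k \<in> span {k. L k = 0}"
    and w: "\<And>k. k \<in> span {k. L k = 0} \<Longrightarrow> orthogonal w k"
    and kw: "scale (y - ystar) = k + w"
    using orthogonal_subspace_decomp_exists by blast
  have span: "span {k. L k = 0} = {k. L k = 0}" using sub by (simp add: span_eq_iff)
  define z where "z = ystar + unscale k"
  have zk: "scale (z - ystar) = k" by (simp add: z_def)
  have zw: "scale (y - z) = w" using kw zk by (simp add: scale_simps algebra_simps)
  have "L k = 0" using k span by blast
  then have "A *v z = 0" by (simp add: z_def matrix_vector_right_distrib steady kernel_L)
  moreover have "w \<in> kernel_perp" using w span by (simp add: kernel_perp_def orthogonal_def)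
  moreover have "(norm (k + w))\<^sup>2 = (norm k)\<^sup>2 + (norm w)\<^sup>2"
    using w[OF k] by (intro norm_add_Pythagorean) (simp add: orthogonal_commute)
  then have "norm k \<le> norm (k + w)" "norm w \<le> norm (k + w)"
    by - (rule power2_le_imp_le; simp)+
  ultimately show ?thesis using that[of z] zk zw kw by simp
qed

text \<open>The linear invariants that fix the steady state of the initial value problem suffice to annihilate
  the component in the kernel: by dissipativity, the weighted version of each kernel vector of
  \<open>L\<close> lies in the kernel of \<open>transpose A\<close>.\<close>

lemma ivp_steady_state_in_kernel_perp:
  assumes "is_steady_state_of_ivp A y0 ystar"
  shows "scale (y0 - ystar) \<in> kernel_perp"
  unfolding kernel_perp_def
proof safe
  fix k assume k: "L k = 0"
  have adj: "k \<bullet> scale v = scale k \<bullet> v" for v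
    by (simp add: inner_vec_def scale_def)
  have "transpose A *v scale k = 0"
  proof (rule vector_eq_innerI)
    fix x
    have "(transpose A *v scale k) \<bullet> x = scale k \<bullet> (A *v x)"
      by (metis dot_lmul_matrix transpose_matrix_vector)
    also have "\<dots> = k \<bullet> scale (A *v x)" by (rule adj[symmetric])
    also have "\<dots> = 0"
      using L_in_kernel_perp[of "scale x"] k dt
      by (simp add: kernel_perp_def L_scale scale_simps inner_commute)
    finally show "(transpose A *v scale k) \<bullet> x = 0 \<bullet> x" by simp
  qed
  then have "scale k \<bullet> ystar = scale k \<bullet> y0"
    using assms by (simp add: is_steady_state_of_ivp_def mat_kernel_def)
  then show "scale (y0 - ystar) \<bullet> k = 0"
    by (simp add: inner_commute[of _ k] adj inner_diff_right)
qed

lemma scale_norm_equiv: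
  obtains a b where "0 < a" "\<And>v. norm (scale v) \<le> a * norm v" "0 < b" "\<And>v. norm v \<le> b * norm (scale v)"
proof -
  obtain a where "0 < a" "\<And>v. norm (scale v) \<le> a * norm v"
    using linear_bounded_pos[OF linear_scale] by blast
  moreover obtain b where "0 < b" "\<And>v. norm (unscale v) \<le> b * norm v"
    using linear_bounded_pos[OF linear_unscale] by blast
  ultimately show ?thesis using that by (metis unscale_scale)
qed

lemma mprk32_lyapunov_stable: "lyapunov_stable_fixed_point (mprk32 A dt) ystar"
proof -
  obtain \<rho> \<delta> where \<rho>: "0 \<le> \<rho>" "\<rho> < 1" and \<delta>: "0 < \<delta>" and
    iter: "\<And>z y n. A *v z = 0 \<Longrightarrow> norm (scale (z - ystar)) < \<delta> \<Longrightarrow>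
     scale (y - z) \<in> kernel_perp \<Longrightarrow> norm (scale (y - z)) < \<delta> \<Longrightarrow>
     norm (scale ((mprk32 A dt ^^ n) y - z)) \<le> \<rho> ^ n * norm (scale (y - z))"
    using iterates_contract by metis
  obtain a b where a: "0 < a" "\<And>v. norm (scale v) \<le> a * norm v"
    and b: "0 < b" "\<And>v. norm v \<le> b * norm (scale v)"
    using scale_norm_equiv by blast
  have "norm (scale (mprk32 A dt ystar - ystar)) \<le> 0"
    using iter[OF steady, of ystar 1] \<delta> by (simp add: scale_simps subspace_0[OF subspace_kernel_perp])
  then have "norm (mprk32 A dt ystar - ystar) \<le> 0"
    using b(2)[of "mprk32 A dt ystar - ystar"] by simp
  then have fixed: "mprk32 A dt ystar = ystar" by simp
  have "\<exists>d>0. \<forall>y. norm (y - ystar) < d \<longrightarrow> (\<forall>n. norm ((mprk32 A dt ^^ n) y - ystar) < e)"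
    if e: "0 < e" for e
  proof -
    define d where "d = min (\<delta> / a) (e / (2 * a * b))"
    have d: "0 < d" "a * d \<le> \<delta>" "b * (2 * (a * d)) \<le> e"
      using \<delta> a(1) b(1) e by (auto simp: d_def min_def field_simps)
    have "norm ((mprk32 A dt ^^ n) y - ystar) < e" if y: "norm (y - ystar) < d" for y n
    proof -
      let ?x = "(mprk32 A dt ^^ n) y"
      obtain z where z: "A *v z = 0" "scale (y - z) \<in> kernel_perp"
        "norm (scale (z - ystar)) \<le> norm (scale (y - ystar))"
        "norm (scale (y - z)) \<le> norm (scale (y - ystar))"
        by (rule steady_state_decomposition)
      have "norm (scale (y - ystar)) \<le> a * norm (y - ystar)" by (rule a)
      also have "\<dots> < a * d" using y a(1) by simp
      finally have sy: "norm (scale (y - ystar)) < a * d" .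
      have "norm (scale (?x - z)) \<le> \<rho> ^ n * norm (scale (y - z))"
        using z sy d(2) by (intro iter) auto
      also have "\<dots> \<le> norm (scale (y - z))"
        using \<rho> by (simp add: mult_left_le_one_le power_le_one)
      finally have "norm (scale (?x - ystar)) < 2 * (a * d)"
        using norm_triangle_ineq[of "scale (?x - z)" "scale (z - ystar)"] z sy
        by (simp add: scale_simps)
      then have "b * norm (scale (?x - ystar)) < b * (2 * (a * d))" using b(1) by simp
      then show ?thesis using b(2)[of "?x - ystar"] d(3) by linarith
    qed
    then show ?thesis using d(1) by blast
  qed
  with fixed show ?thesis unfolding lyapunov_stable_fixed_point_def by blast
qed

lemma mprk32_locally_convergent:
  "\<exists>\<delta>>0. \<forall>y0. is_steady_state_of_ivp A y0 ystar \<longrightarrow> norm (y0 - ystar) < \<delta> \<longrightarrow>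
     (\<lambda>n. (mprk32 A dt ^^ n) y0) \<longlonglongrightarrow> ystar"
proof -
  obtain \<rho> \<delta> where \<rho>: "0 \<le> \<rho>" "\<rho> < 1" and \<delta>: "0 < \<delta>" and
    iter: "\<And>z y n. A *v z = 0 \<Longrightarrow> norm (scale (z - ystar)) < \<delta> \<Longrightarrow>
     scale (y - z) \<in> kernel_perp \<Longrightarrow> norm (scale (y - z)) < \<delta> \<Longrightarrow>
     norm (scale ((mprk32 A dt ^^ n) y - z)) \<le> \<rho> ^ n * norm (scale (y - z))"
    using iterates_contract by metis
  obtain a b where a: "0 < a" "\<And>v. norm (scale v) \<le> a * norm v"
    and b: "0 < b" "\<And>v. norm v \<le> b * norm (scale v)"
    using scale_norm_equiv by blast
  have "(\<lambda>n. (mprk32 A dt ^^ n) y0) \<longlonglongrightarrow> ystar"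
    if y0: "is_steady_state_of_ivp A y0 ystar" "norm (y0 - ystar) < \<delta> / a" for y0
  proof -
    have "norm (scale (y0 - ystar)) < \<delta>"
      using a(2)[of "y0 - ystar"] y0(2) a(1) by (simp add: field_simps)
    then have it: "norm (scale ((mprk32 A dt ^^ n) y0 - ystar)) \<le> \<rho> ^ n * norm (scale (y0 - ystar))" for n
      using \<delta> by (intro iter steady ivp_steady_state_in_kernel_perp y0(1)) (simp_all add: scale_simps)
    have "(\<lambda>n. (mprk32 A dt ^^ n) y0 - ystar) \<longlonglongrightarrow> 0"
    proof (rule Lim_null_comparison)
      show "\<forall>\<^sub>F n in sequentially. norm ((mprk32 A dt ^^ n) y0 - ystar)
          \<le> b * (\<rho> ^ n * norm (scale (y0 - ystar)))"
        using b(1) by (intro always_eventually allI order_trans[OF b(2)] mult_left_mono it) simp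
      show "(\<lambda>n. b * (\<rho> ^ n * norm (scale (y0 - ystar)))) \<longlonglongrightarrow> 0"
        by (rule tendsto_mult_right_zero, rule tendsto_mult_left_zero, rule LIMSEQ_realpow_zero[OF \<rho>])
    qed
    then show ?thesis by (simp add: LIM_zero_iff)
  qed
  then show ?thesis using \<delta> a(1) by (intro exI[of _ "\<delta> / a"]) auto
qed

end

theorem corollary3p2:
  fixes A :: "real^'n^'n"
  assumes "standing_assumptions A"
  shows "(\<forall>ystar. positive_vec ystar \<and> A *v ystar = 0 \<longrightarrow>
            (\<forall>dt>0. lyapunov_stable_fixed_point (mprk32 A dt) ystar)) \<and>
         (\<forall>ystar. positive_vec ystar \<longrightarrow>
            (\<forall>dt>0. \<exists>\<delta>>0. \<forall>y0. positive_vec y0 \<longrightarrow> is_steady_state_of_ivp A y0 ystar \<longrightarrow>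
               norm (y0 - ystar) < \<delta> \<longrightarrow> (\<lambda>n. (mprk32 A dt ^^ n) y0) \<longlonglongrightarrow> ystar))"
proof (intro conjI allI impI)
  fix ystar :: "real^'n" and dt :: real
  assume "positive_vec ystar \<and> A *v ystar = 0" "0 < dt"
  then interpret positive_steady_state A ystar dt
    using assms by unfold_locales auto
  show "lyapunov_stable_fixed_point (mprk32 A dt) ystar" by (rule mprk32_lyapunov_stable)
next
  fix ystar :: "real^'n" and dt :: real
  assume ystar: "positive_vec ystar" and dt: "0 < dt"
  show "\<exists>\<delta>>0. \<forall>y0. positive_vec y0 \<longrightarrow> is_steady_state_of_ivp A y0 ystar \<longrightarrow>
     norm (y0 - ystar) < \<delta> \<longrightarrow> (\<lambda>n. (mprk32 A dt ^^ n) y0) \<longlonglongrightarrow> ystar"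
  proof (cases "A *v ystar = 0")
    case True
    then interpret positive_steady_state A ystar dt
      using assms ystar dt by unfold_locales
    show ?thesis using mprk32_locally_convergent by blast
  next
    \<comment> \<open>No initial value has \<open>ystar\<close> as its steady state.\<close>
    case False
    then show ?thesis by (intro exI[of _ 1]) (simp add: is_steady_state_of_ivp_def)
  qed
qed

end
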